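(* Every graph $G$ satisfies \[\chi(G) \leq \frac{\iota(G) + \omega(G) + \Delta(G) + |G| + 2}{4}.\]
   Context: Graphs are finite and simple. For a graph $G$, $|G|$ is the number of vertices (also written $n$), $\chi(G)$ the chromatic number, $\omega(G)$ the clique number, and $\Delta(G)$ the maximum degree. A coloring of $G$ is identified with its set of color classes, i.e. a partition of $V(G)$ into nonempty independent sets; it is optimal if it has exactly $\chi(G)$ color classes. The stinginess $\iota(G)$ of $G$ is the maximum number of singleton color classes (color classes of order $1$) appearing in an optimal coloring of $G$. *)

theory Defs
  imports Complex_Main "HOL-Library.Disjoint_Sets" "Graph_Theory.Digraph"
begin

text \<open>
  Finite simple graphs are those satisfying the locale predicate \<^const>\<open>graph\<close>: finite, loop-free
  symmetric digraphs without parallel arcs. An undirected edge is a pair of opposite arcs, and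
  \<open>u \<rightarrow>\<^bsub>G\<^esub> v\<close> is adjacency.
\<close>

definition independent_set :: "('a, 'b) pre_digraph \<Rightarrow> 'a set \<Rightarrow> bool" where
  "independent_set G S \<longleftrightarrow> S \<subseteq> verts G \<and> (\<forall>u\<in>S. \<forall>v\<in>S. \<not> u \<rightarrow>\<^bsub>G\<^esub> v)"

definition clique_set :: "('a, 'b) pre_digraph \<Rightarrow> 'a set \<Rightarrow> bool" where
  "clique_set G K \<longleftrightarrow> K \<subseteq> verts G \<and> (\<forall>u\<in>K. \<forall>v\<in>K. u \<noteq> v \<longrightarrow> u \<rightarrow>\<^bsub>G\<^esub> v)"

definition coloring :: "('a, 'b) pre_digraph \<Rightarrow> 'a set set \<Rightarrow> bool" where
  "coloring G C \<longleftrightarrow> partition_on (verts G) C \<and> (\<forall>S\<in>C. independent_set G S)"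

definition chromatic_number :: "('a, 'b) pre_digraph \<Rightarrow> nat" where
  "chromatic_number G = (LEAST k. \<exists>C. coloring G C \<and> card C = k)"

definition optimal_coloring :: "('a, 'b) pre_digraph \<Rightarrow> 'a set set \<Rightarrow> bool" where
  "optimal_coloring G C \<longleftrightarrow> coloring G C \<and> card C = chromatic_number G"

definition stinginess :: "('a, 'b) pre_digraph \<Rightarrow> nat" where
  "stinginess G = Max {card {S \<in> C. card S = 1} | C. optimal_coloring G C}"

definition clique_number :: "('a, 'b) pre_digraph \<Rightarrow> nat" where
  "clique_number G = Max {card K | K. clique_set G K}"

text \<open>
  The degree of \<open>v\<close> is \<open>out_degree G v\<close>, see \<open>out_degree_eq_card_neighbours\<close> below. Inserting \<open>0\<close>
  only matters for the graph without vertices, whose maximum degree is taken to be \<open>0\<close>.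
\<close>
definition max_degree :: "('a, 'b) pre_digraph \<Rightarrow> nat" where
  "max_degree G = Max (insert 0 (out_degree G ` verts G))"

lemma (in graph) out_degree_eq_card_neighbours:
  "out_degree G v = card {u \<in> verts G. v \<rightarrow>\<^bsub>G\<^esub> u}"
proof -
  have inj: "inj_on (head G) (out_arcs G v)"
    by (rule inj_onI) (auto simp: arc_to_ends_def intro: no_multi_arcs)
  have "head G ` out_arcs G v = {u \<in> verts G. v \<rightarrow>\<^bsub>G\<^esub> u}"
    by (auto simp: arcs_ends_conv)
  with card_image[OF inj] show ?thesis
    by (simp add: out_degree_def)
qed

text \<open>
  The sets under \<open>LEAST\<close> and \<open>Max\<close> above are nonempty, and those under \<open>Max\<close> finite.
\<close>

lemma (in graph) finite_colorings: "finite {C. coloring G C}"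
proof (rule finite_subset)
  show "{C. coloring G C} \<subseteq> Pow (Pow (verts G))"
    by (auto simp: coloring_def independent_set_def)
qed simp

lemma (in graph) coloring_exists: "\<exists>C. coloring G C"
proof
  have "partition_on (verts G) ((\<lambda>v. {v}) ` verts G)"
    by (rule partition_onI) (auto simp: disjnt_def)
  then show "coloring G ((\<lambda>v. {v}) ` verts G)"
    by (auto simp: coloring_def independent_set_def dest: adj_not_same)
qed

lemma (in graph) optimal_coloring_exists: "\<exists>C. optimal_coloring G C"
  unfolding optimal_coloring_def chromatic_number_def
  by (rule LeastI_ex) (use coloring_exists in blast)

lemma (in graph) stinginess_set:
  "finite {card {S \<in> C. card S = 1} | C. optimal_coloring G C}"
  "{card {S \<in> C. card S = 1} | C. optimal_coloring G C} \<noteq> {}"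
proof -
  have "finite {C. optimal_coloring G C}"
    by (rule finite_subset[OF _ finite_colorings]) (auto simp: optimal_coloring_def)
  then show "finite {card {S \<in> C. card S = 1} | C. optimal_coloring G C}"
    by (simp add: setcompr_eq_image)
  show "{card {S \<in> C. card S = 1} | C. optimal_coloring G C} \<noteq> {}"
    using optimal_coloring_exists by blast
qed

lemma (in graph) clique_number_set:
  "finite {card K | K. clique_set G K}" "{card K | K. clique_set G K} \<noteq> {}"
proof -
  have "finite {K. clique_set G K}"
    by (rule finite_subset[of _ "Pow (verts G)"]) (auto simp: clique_set_def)
  then show "finite {card K | K. clique_set G K}"
    by (simp add: setcompr_eq_image)
  have "clique_set G {}"
    by (simp add: clique_set_def)
  then show "{card K | K. clique_set G K} \<noteq> {}"
    by blast
qed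

end

theory Submission
  imports Defs
begin

text \<open>
  The proof is an induction on the number of vertices; throughout, an optimal coloring has
  \<open>s\<close> singleton classes, and \<open>n\<close> is the number of vertices.

  If an optimal coloring has a class with at least three vertices, that class is enlarged to a maximal
  independent set and removed. This lowers \<open>\<chi>\<close> by one, \<open>n\<close> by at least three and, if vertices
  remain, \<open>\<Delta>\<close> by at least one, and a coloring of the rest extends without changing its singleton classes
  (\<open>stingy_bound_remove_class\<close>). Otherwise all classes are singletons or pairs, so
  \<open>2 \<chi> = n + s\<close>, and it remains to prove the inequality \<open>2 \<chi> \<le> \<omega> + \<Delta> + 2\<close>, a weak form of the bound
  in Reed's conjecture. Without an independent triple and with \<open>s \<le> 1\<close> it holds because the
  vertices other than a given one and its neighbours form a clique (\<open>reed_bound_no_triple\<close>). In the other cases it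
  reduces to graphs with \<open>n \<le> 2 \<chi> - 2\<close>: either \<open>s \<ge> 2\<close>, or an independent triple can be deleted,
  which does not lower \<open>\<chi>\<close>.

  So let \<open>n \<le> 2 \<chi> - 2\<close> (\<open>reed_bound_large_chi\<close>). Vertices that are not critical can be
  deleted, and a vertex-critical graph with so few vertices is a join of two nonempty graphs \<open>A\<close>
  and \<open>B\<close>, by a theorem of Gallai (\<open>critical_small_join\<close>). The singleton classes of an optimal
  coloring form a clique, so the theorem for \<open>A\<close> and \<open>B\<close> bounds \<open>4 \<chi>\<close> by \<open>2 \<omega> + \<Delta> + n + 2\<close> on
  each side. Adding the two bounds gives exactly what is needed, since \<open>\<chi>\<close> and \<open>\<omega>\<close> are additive
  and both \<open>\<Delta>(A) + |B|\<close> and \<open>\<Delta>(B) + |A|\<close> are at most the maximum degree of the join.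

  Gallai's theorem itself is proved with Hall's theorem (\<open>gallai_step\<close>): after the removal of a
  suitable set \<open>X\<close> the graph splits into at least \<open>|X|\<close> mutually joined parts, and a matching of
  vertices in \<open>X\<close> into parts would make those vertices superfluous for \<open>\<chi>\<close>.
\<close>

section \<open>Hall's marriage theorem and its deficiency version\<close>

text \<open>
  Induction on the number of elements to be married. If some proper nonempty \<open>Z\<close> has no neighbour
  to spare, \<open>Z\<close> and its complement can be married separately, the complement avoiding the
  neighbours of \<open>Z\<close>. Otherwise every proper subset has a neighbour to spare, so one element can be
  married arbitrarily.
\<close>

lemma hall:
  assumes "finite X" "\<And>x. x \<in> X \<Longrightarrow> finite (N x)"
    and "\<And>Z. Z \<subseteq> X \<Longrightarrow> card Z \<le> card (\<Union>(N ` Z))"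
  shows "\<exists>f. inj_on f X \<and> (\<forall>x\<in>X. f x \<in> N x)"
  using assms
proof (induction "card X" arbitrary: X N rule: less_induct)
  case less
  note finX = less.prems(1) and finN = less.prems(2) and cond = less.prems(3)
  show ?case
  proof (cases "\<exists>Z. Z \<noteq> {} \<and> Z \<subset> X \<and> card (\<Union>(N ` Z)) \<le> card Z")
    case True
    then obtain Z where Z: "Z \<noteq> {}" "Z \<subset> X" "card (\<Union>(N ` Z)) \<le> card Z"
      by blast
    have finZ: "finite Z"
      using Z(2) finX by (auto intro: finite_subset)
    have "\<exists>f. inj_on f Z \<and> (\<forall>x\<in>Z. f x \<in> N x)"
    proof (rule less.hyps)
      show "card Z < card X"
        using Z(2) finX by (rule psubset_card_mono[rotated])
      show "card W \<le> card (\<Union>(N ` W))" if "W \<subseteq> Z" for W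
        using that Z(2) by (intro cond) auto
    qed (use Z(2) finZ finN in auto)
    then obtain f where f: "inj_on f Z" "\<forall>x\<in>Z. f x \<in> N x"
      by blast
    define N' where "N' x = N x - \<Union>(N ` Z)" for x
    have "card W \<le> card (\<Union>(N' ` W))" if W: "W \<subseteq> X - Z" for W
    proof -
      have finW: "finite W" using W finX by (meson finite_Diff finite_subset)
      have "card W + card Z = card (W \<union> Z)"
        using W finW finZ by (subst card_Un_disjoint) auto
      also have "\<dots> \<le> card (\<Union>(N ` (W \<union> Z)))"
        using W Z(2) by (intro cond) auto
      also have "\<Union>(N ` (W \<union> Z)) = \<Union>(N' ` W) \<union> \<Union>(N ` Z)"
        unfolding N'_def by auto
      also have "card \<dots> \<le> card (\<Union>(N' ` W)) + card (\<Union>(N ` Z))"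
        by (rule card_Un_le)
      finally show ?thesis using Z(3) by linarith
    qed
    moreover have "card (X - Z) < card X"
      using Z finX by (intro psubset_card_mono) auto
    ultimately have "\<exists>g. inj_on g (X - Z) \<and> (\<forall>x\<in>X - Z. g x \<in> N' x)"
      using less.hyps[of "X - Z" N'] finX finN by (auto simp: N'_def)
    then obtain g where g: "inj_on g (X - Z)" "\<forall>x\<in>X - Z. g x \<in> N' x"
      by blast
    define h where "h x = (if x \<in> Z then f x else g x)" for x
    have "f ` Z \<inter> g ` (X - Z) = {}"
      using f(2) g(2) by (fastforce simp: N'_def)
    then have "inj_on (\<lambda>x. if x \<in> Z then f x else g x) (Z \<union> (X - Z))"
      by (rule inj_on_disjoint_Un[OF f(1) g(1)])
    then have "inj_on h X"
      using Z(2) by (simp add: h_def[abs_def] Un_absorb1 psubset_imp_subset)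
    moreover have "\<forall>x\<in>X. h x \<in> N x"
      using f g by (auto simp: h_def N'_def)
    ultimately show ?thesis by blast
  next
    case False
    show ?thesis
    proof (cases "X = {}")
      case False
      then obtain x where x: "x \<in> X" by blast
      have "card {x} \<le> card (\<Union>(N ` {x}))" using x by (intro cond) auto
      then obtain y where y: "y \<in> N x" by fastforce
      define N' where "N' z = N z - {y}" for z
      have "card W \<le> card (\<Union>(N' ` W))" if W: "W \<subseteq> X - {x}" for W
      proof (cases "W = {}")
        case False
        have "W \<subset> X" using W x by auto
        then have "card W < card (\<Union>(N ` W))"
          using \<open>\<not> (\<exists>Z. _ Z)\<close> False by (meson not_le)
        moreover have "\<Union>(N' ` W) = \<Union>(N ` W) - {y}"
          by (auto simp: N'_def)
        moreover have "card (\<Union>(N ` W)) \<le> card (\<Union>(N ` W) - {y}) + 1"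
          using diff_card_le_card_Diff[of "{y}" "\<Union>(N ` W)"] by simp
        ultimately show ?thesis by simp
      qed simp
      then have "\<exists>g. inj_on g (X - {x}) \<and> (\<forall>z\<in>X - {x}. g z \<in> N' z)"
        using less.hyps[of "X - {x}" N'] finX finN card_Diff1_less[OF finX x] by (auto simp: N'_def)
      then obtain g where g: "inj_on g (X - {x})" "\<forall>z\<in>X - {x}. g z \<in> N' z"
        by blast
      have "inj_on (g(x := y)) X"
        using g unfolding inj_on_def N'_def by auto
      moreover have "\<forall>z\<in>X. (g(x := y)) z \<in> N z"
        using g y by (auto simp: N'_def)
      ultimately show ?thesis by blast
    qed simp
  qed
qed

text \<open>
  A set \<open>Y\<close> of maximal deficiency absorbs every violation of Hall's condition: outside \<open>Y\<close>, and
  with the neighbours of \<open>Y\<close> removed, a violating set could be added to \<open>Y\<close> and would increase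
  the deficiency.
\<close>

lemma hall_deficiency:
  assumes finX: "finite X" and finN: "\<And>x. x \<in> X \<Longrightarrow> finite (N x)"
  obtains Y f where "Y \<subseteq> X" "Y = {} \<or> card (\<Union>(N ` Y)) < card Y"
    "inj_on f (X - Y)" "\<And>x. x \<in> X - Y \<Longrightarrow> f x \<in> N x - \<Union>(N ` Y)"
proof -
  define d where "d Z = int (card Z) - int (card (\<Union>(N ` Z)))" for Z
  have fin: "finite (d ` Pow X)" and ne: "d ` Pow X \<noteq> {}"
    using finX by auto
  obtain Y0 where Y0: "Y0 \<subseteq> X" "d Y0 = Max (d ` Pow X)"
    using Max_in[OF fin ne] by auto
  have Y0_max: "d Z \<le> d Y0" if "Z \<subseteq> X" for Z
    using Max_ge[OF fin] that Y0(2) by auto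
  \<comment> \<open>The empty set has deficiency \<open>0\<close>; preferring it in a tie leaves a strict violation for a nonempty \<open>Y\<close>.\<close>
  define Y where "Y = (if d Y0 \<le> 0 then {} else Y0)"
  have YX: "Y \<subseteq> X" using Y0(1) by (simp add: Y_def)
  have Y_pos: "Y = {} \<or> card (\<Union>(N ` Y)) < card Y"
    by (simp add: Y_def d_def)
  have Y_max: "d Z \<le> d Y" if "Z \<subseteq> X" for Z
    using Y0_max[OF that] by (auto simp: Y_def d_def)
  have "\<exists>f. inj_on f (X - Y) \<and> (\<forall>x\<in>X - Y. f x \<in> N x - \<Union>(N ` Y))"
  proof (rule hall)
    fix Z assume Z: "Z \<subseteq> X - Y"
    have finZ: "finite Z" "finite Y" using Z YX finX by (auto intro: finite_subset)
    have N_Un: "\<Union>(N ` (Z \<union> Y)) = \<Union>((\<lambda>x. N x - \<Union>(N ` Y)) ` Z) \<union> \<Union>(N ` Y)"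
      by auto
    have "int (card (Z \<union> Y)) - int (card (\<Union>(N ` (Z \<union> Y)))) \<le> int (card Y) - int (card (\<Union>(N ` Y)))"
      using Y_max[of "Z \<union> Y"] Z YX by (auto simp: d_def)
    moreover have "card (Z \<union> Y) = card Z + card Y"
      using Z finZ by (intro card_Un_disjoint) auto
    moreover have "card (\<Union>(N ` (Z \<union> Y)))
        \<le> card (\<Union>((\<lambda>x. N x - \<Union>(N ` Y)) ` Z)) + card (\<Union>(N ` Y))"
      unfolding N_Un by (rule card_Un_le)
    ultimately show "card Z \<le> card (\<Union>((\<lambda>x. N x - \<Union>(N ` Y)) ` Z))"
      by linarith
  qed (use finX finN in auto)
  then show ?thesis using that[OF YX Y_pos] by blast
qed

section \<open>The chromatic number of a set of vertices\<close>

text \<open>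
  A fixed adjacency relation together with a varying finite set of vertices stands for a graph
  together with its induced subgraphs, which the inductions below run through.
\<close>

locale adjacency =
  fixes adj :: "'a \<Rightarrow> 'a \<Rightarrow> bool"
  assumes adj_sym: "adj u v \<Longrightarrow> adj v u"
    and adj_irrefl: "\<not> adj u u"
begin

definition indep :: "'a set \<Rightarrow> bool" where
  "indep S \<longleftrightarrow> (\<forall>u\<in>S. \<forall>v\<in>S. \<not> adj u v)"

definition clique :: "'a set \<Rightarrow> bool" where
  "clique K \<longleftrightarrow> (\<forall>u\<in>K. \<forall>v\<in>K. u \<noteq> v \<longrightarrow> adj u v)"

definition joined :: "'a set \<Rightarrow> 'a set \<Rightarrow> bool" where
  "joined A B \<longleftrightarrow> (\<forall>a\<in>A. \<forall>b\<in>B. adj a b)"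

definition indep_cover :: "'a set \<Rightarrow> 'a set set \<Rightarrow> bool" where
  "indep_cover V C \<longleftrightarrow> finite C \<and> V \<subseteq> \<Union>C \<and> (\<forall>S\<in>C. indep S)"

text \<open>
  Covers, unlike partitions, may overlap and may leave the set. Restricting and uniting them
  needs no repair, and the least size is the same, see \<open>partition_from_cover\<close>.
\<close>

definition chi :: "'a set \<Rightarrow> nat" where
  "chi V = (LEAST k. \<exists>C. indep_cover V C \<and> card C = k)"

definition omega :: "'a set \<Rightarrow> nat" where
  "omega V = Max (card ` {K. K \<subseteq> V \<and> clique K})"

definition degree :: "'a set \<Rightarrow> 'a \<Rightarrow> nat" where
  "degree V v = card {u \<in> V. adj v u}"

definition Delta :: "'a set \<Rightarrow> nat" where
  "Delta V = Max (insert 0 (degree V ` V))"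

definition critical :: "'a set \<Rightarrow> bool" where
  "critical V \<longleftrightarrow> (\<forall>v\<in>V. chi (V - {v}) < chi V)"

definition optimal :: "'a set \<Rightarrow> 'a set set \<Rightarrow> bool" where
  "optimal V C \<longleftrightarrow> partition_on V C \<and> (\<forall>S\<in>C. indep S) \<and> card C = chi V"

lemma indep_subset: "indep S \<Longrightarrow> T \<subseteq> S \<Longrightarrow> indep T"
  by (auto simp: indep_def)

lemma indep_singleton: "indep {v}"
  by (simp add: indep_def adj_irrefl)

lemma joined_sym: "joined A B \<Longrightarrow> joined B A"
  by (auto simp: joined_def adj_sym)

lemma joined_disjoint: "joined A B \<Longrightarrow> A \<inter> B = {}"
  using adj_irrefl by (fastforce simp: joined_def)

lemma chi_le: "indep_cover V C \<Longrightarrow> chi V \<le> card C"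
  unfolding chi_def by (rule Least_le) blast

lemma obtain_cover:
  assumes "finite V"
  obtains C where "indep_cover V C" "card C = chi V"
proof -
  have "indep_cover V ((\<lambda>v. {v}) ` V)"
    using assms by (auto simp: indep_cover_def indep_singleton)
  then have "\<exists>k C. indep_cover V C \<and> card C = k"
    by blast
  from LeastI_ex[OF this] have "\<exists>C. indep_cover V C \<and> card C = chi V"
    by (simp only: chi_def)
  then show ?thesis using that by blast
qed

lemma chi_mono:
  assumes "finite V" "W \<subseteq> V"
  shows "chi W \<le> chi V"
proof -
  obtain C where C: "indep_cover V C" "card C = chi V"
    using obtain_cover[OF assms(1)] .
  then have "indep_cover W C" using assms(2) by (auto simp: indep_cover_def)
  then show ?thesis using chi_le[of W C] C(2) by simp
qed

lemma chi_Un_le: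
  assumes "finite V" "finite W"
  shows "chi (V \<union> W) \<le> chi V + chi W"
proof -
  obtain C where C: "indep_cover V C" "card C = chi V"
    using obtain_cover[OF assms(1)] .
  obtain D where D: "indep_cover W D" "card D = chi W"
    using obtain_cover[OF assms(2)] .
  have "indep_cover (V \<union> W) (C \<union> D)"
    using C D by (auto simp: indep_cover_def)
  from chi_le[OF this] show ?thesis
    using card_Un_le[of C D] C(2) D(2) by linarith
qed

lemma chi_empty [simp]: "chi {} = 0"
  using chi_le[of "{}" "{}"] by (simp add: indep_cover_def)

lemma chi_indep: "indep S \<Longrightarrow> chi S \<le> 1"
  using chi_le[of S "{S}"] by (simp add: indep_cover_def)

text \<open>
  An independent set cannot meet both of two completely joined sets, so a cover splits into a
  part for \<open>A\<close> and a part for \<open>B\<close>. The set \<open>V\<close> may contain further vertices.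
\<close>

lemma chi_joined_ge:
  assumes fin: "finite V" and sub: "A \<subseteq> V" "B \<subseteq> V" and j: "joined A B"
  shows "chi A + chi B \<le> chi V"
proof -
  obtain C where C: "indep_cover V C" "card C = chi V"
    using obtain_cover[OF fin] .
  define CA where "CA = {S \<in> C. S \<inter> A \<noteq> {}}"
  define CB where "CB = {S \<in> C. S \<inter> B \<noteq> {}}"
  have "A \<subseteq> \<Union>CA" "B \<subseteq> \<Union>CB"
    using C(1) sub unfolding CA_def CB_def indep_cover_def by blast+
  then have "indep_cover A CA" "indep_cover B CB"
    using C(1) by (auto simp: CA_def CB_def indep_cover_def)
  then have "chi A + chi B \<le> card CA + card CB"
    by (intro add_mono chi_le)
  also have "\<dots> = card (CA \<union> CB)"
  proof (rule card_Un_disjoint[symmetric])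
    show "CA \<inter> CB = {}"
    proof (rule ccontr)
      assume "CA \<inter> CB \<noteq> {}"
      then obtain S a b where "S \<in> C" "a \<in> S" "a \<in> A" "b \<in> S" "b \<in> B"
        unfolding CA_def CB_def by blast
      then show False using C(1) j unfolding indep_cover_def indep_def joined_def by blast
    qed
  qed (use C(1) in \<open>auto simp: CA_def CB_def indep_cover_def\<close>)
  also have "\<dots> \<le> card C"
    using C(1) by (intro card_mono) (auto simp: CA_def CB_def indep_cover_def)
  finally show ?thesis using C(2) by simp
qed

lemma chi_joined:
  assumes "finite A" "finite B" "joined A B"
  shows "chi (A \<union> B) = chi A + chi B"
  using chi_Un_le[OF assms(1,2)] chi_joined_ge[of "A \<union> B" A B] assms by auto

lemma chi_Union_joined:
  assumes "finite \<P>" "\<And>P. P \<in> \<P> \<Longrightarrow> finite P"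
    and "\<And>P Q. P \<in> \<P> \<Longrightarrow> Q \<in> \<P> \<Longrightarrow> P \<noteq> Q \<Longrightarrow> joined P Q"
  shows "chi (\<Union>\<P>) = sum chi \<P>"
  using assms
proof (induction rule: finite_induct)
  case (insert P \<P>)
  have "joined P (\<Union>\<P>)"
    unfolding joined_def
  proof (intro ballI)
    fix a b assume ab: "a \<in> P" "b \<in> \<Union>\<P>"
    then obtain Q where Q: "Q \<in> \<P>" "b \<in> Q" by blast
    then have "joined P Q" using insert by blast
    then show "adj a b" using ab(1) Q(2) by (auto simp: joined_def)
  qed
  then have "chi (P \<union> \<Union>\<P>) = chi P + chi (\<Union>\<P>)"
    using insert by (intro chi_joined) auto
  then show ?case using insert by simp
qed simp

lemma chi_UN_le:
  assumes "finite I" "\<And>i. i \<in> I \<Longrightarrow> finite (V i)"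
  shows "chi (\<Union>i\<in>I. V i) \<le> (\<Sum>i\<in>I. chi (V i))"
  using assms
proof (induction rule: finite_induct)
  case (insert i I)
  have "chi (V i \<union> (\<Union>i\<in>I. V i)) \<le> chi (V i) + chi (\<Union>i\<in>I. V i)"
    using insert by (intro chi_Un_le) auto
  then show ?case using insert by fastforce
qed simp

text \<open>
  Colour \<open>P - {d}\<close> with one colour fewer and give \<open>x\<close> and \<open>d\<close> a common new colour.
\<close>

lemma chi_critical_insert:
  assumes "finite P" "critical P" "d \<in> P" "\<not> adj x d"
  shows "chi (insert x P) \<le> chi P"
proof -
  have "insert x P = (P - {d}) \<union> {x, d}" using assms(3) by auto
  then have "chi (insert x P) \<le> chi (P - {d}) + chi {x, d}"
    using chi_Un_le[of "P - {d}" "{x, d}"] assms(1) by simp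
  moreover have "indep {x, d}"
    using assms(4) adj_sym by (auto simp: indep_def adj_irrefl)
  ultimately show ?thesis
    using assms(2,3) chi_indep[of "{x, d}"] by (fastforce simp: critical_def)
qed

section \<open>Critical graphs with few vertices are joins\<close>

text \<open>
  In the complement graph, the parts are unions of connected components. The bound on their
  chromatic numbers says that none of them is a further instance of Gallai's theorem.
\<close>

definition join_partition :: "'a set \<Rightarrow> 'a set set \<Rightarrow> bool" where
  "join_partition V \<P> \<longleftrightarrow> partition_on V \<P> \<and>
     (\<forall>P\<in>\<P>. critical P \<and> 2 * chi P \<le> card P + 1) \<and>
     (\<forall>P\<in>\<P>. \<forall>Q\<in>\<P>. P \<noteq> Q \<longrightarrow> joined P Q)"

lemma card_partition_sum:
  assumes "finite V" "partition_on V \<P>"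
  shows "card V = (\<Sum>P\<in>\<P>. card P)"
proof -
  have "card (\<Union>\<P>) = (\<Sum>P\<in>\<P>. card P)"
  proof (rule card_Union_disjoint)
    show "pairwise disjnt \<P>" using assms(2) by (rule partition_onD2)
    show "finite P" if "P \<in> \<P>" for P
      using that assms partition_onD1 by (metis Union_upper finite_subset)
  qed
  then show ?thesis using assms(2) partition_onD1 by metis
qed

lemma join_partition_card:
  assumes "finite V" "join_partition V \<P>"
  shows "2 * chi V \<le> card V + card \<P>"
proof -
  have part: "partition_on V \<P>" using assms(2) by (simp add: join_partition_def)
  have finP: "finite \<P>" using finite_elements[OF assms(1) part] .
  have V: "V = \<Union>\<P>" using part by (rule partition_onD1)
  have "chi V = sum chi \<P>"
    unfolding V
  proof (rule chi_Union_joined[OF finP])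
    show "finite P" if "P \<in> \<P>" for P
      using that assms(1) V by (metis Union_upper finite_subset)
  qed (use assms(2) in \<open>auto simp: join_partition_def\<close>)
  then have "2 * chi V = (\<Sum>P\<in>\<P>. 2 * chi P)"
    by (simp add: sum_distrib_left)
  also have "\<dots> \<le> (\<Sum>P\<in>\<P>. card P + 1)"
    using assms(2) by (intro sum_mono) (auto simp: join_partition_def)
  also have "\<dots> = card V + card \<P>"
    unfolding card_partition_sum[OF assms(1) part] by (subst sum.distrib) simp
  finally show ?thesis .
qed

text \<open>
  Each vertex of \<open>X\<close> is absorbed by its own part, at no cost because that part is critical. This
  is why distinct parts are needed, hence Hall's theorem.
\<close>

lemma chi_matched_union:
  assumes fin: "finite \<F>" "\<And>P. P \<in> \<F> \<Longrightarrow> finite P"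
    and crit: "\<And>P. P \<in> \<F> \<Longrightarrow> critical P"
    and joined: "\<And>P Q. P \<in> \<F> \<Longrightarrow> Q \<in> \<F> \<Longrightarrow> P \<noteq> Q \<Longrightarrow> joined P Q"
    and inj: "inj_on f X" and f: "\<And>x. x \<in> X \<Longrightarrow> f x \<in> \<F> \<and> \<not> joined {x} (f x)"
  shows "chi (\<Union>\<F> \<union> X) \<le> chi (\<Union>\<F>)"
proof -
  \<comment> \<open>The vertices of \<open>X\<close> are distributed to their parts; by injectivity a part gains at most one.\<close>
  define W where "W P = P \<union> {x \<in> X. f x = P}" for P
  have W_cases: "W P = P \<or> (\<exists>x\<in>X. f x = P \<and> W P = insert x P)" for P
    using inj unfolding W_def inj_on_def by blast
  have W: "finite (W P) \<and> chi (W P) \<le> chi P" if P: "P \<in> \<F>" for P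
    using W_cases[of P]
  proof
    assume "W P = P" then show ?thesis using fin(2)[OF P] by simp
  next
    assume "\<exists>x\<in>X. f x = P \<and> W P = insert x P"
    then obtain x where x: "x \<in> X" "f x = P" "W P = insert x P" by blast
    then obtain d where "d \<in> P" "\<not> adj x d"
      using f[OF x(1)] by (auto simp: joined_def)
    then show ?thesis
      using chi_critical_insert[OF fin(2)[OF P] crit[OF P]] x(3) fin(2)[OF P] by simp
  qed
  have "\<Union>\<F> \<union> X = (\<Union>P\<in>\<F>. W P)"
    using f by (auto simp: W_def)
  then have "chi (\<Union>\<F> \<union> X) \<le> (\<Sum>P\<in>\<F>. chi (W P))"
    using chi_UN_le[OF fin(1), of W] W by simp
  also have "\<dots> \<le> (\<Sum>P\<in>\<F>. chi P)"
    using W by (intro sum_mono) blast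
  also have "\<dots> = chi (\<Union>\<F>)"
    using chi_Union_joined[OF fin joined] by simp
  finally show ?thesis .
qed

text \<open>
  Deleting one vertex lowers the chromatic number by exactly one. If the deleted set is as large
  as possible for this loss, then deleting any further vertex costs another colour.
\<close>

lemma obtain_maximal_deletion:
  assumes fin: "finite V" and crit: "critical V" and ne: "V \<noteq> {}"
  obtains X where "X \<subseteq> V" "X \<noteq> {}" "chi (V - X) + 1 = chi V" "critical (V - X)"
proof -
  define \<X> where "\<X> = {X. X \<subseteq> V \<and> X \<noteq> {} \<and> chi (V - X) + 1 = chi V}"
  obtain v where v: "v \<in> V" using ne by blast
  have "chi V \<le> chi (V - {v}) + chi {v}"
    using chi_Un_le[of "V - {v}" "{v}"] fin v by (simp add: insert_absorb)
  then have "{v} \<in> \<X>"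
    using v crit chi_indep[OF indep_singleton, of v] by (fastforce simp: \<X>_def critical_def)
  moreover have "finite \<X>"
    by (rule finite_subset[of _ "Pow V"]) (use fin in \<open>auto simp: \<X>_def\<close>)
  ultimately obtain X where X: "X \<in> \<X>" "\<And>Y. Y \<in> \<X> \<Longrightarrow> X \<subseteq> Y \<Longrightarrow> X = Y"
    using finite_has_maximal[of \<X>] by blast
  have "chi (V - X - {w}) < chi (V - X)" if w: "w \<in> V - X" for w
  proof -
    have "insert w X \<notin> \<X>" using X(2)[of "insert w X"] w by blast
    then have "chi (V - X - {w}) + 1 \<noteq> chi V"
      using w X(1) by (auto simp: \<X>_def Diff_insert[symmetric])
    moreover have "chi (V - X - {w}) \<le> chi (V - X)"
      using fin by (intro chi_mono) auto
    ultimately show ?thesis using X(1) by (simp add: \<X>_def)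
  qed
  then show ?thesis using that[of X] X(1) by (auto simp: \<X>_def critical_def)
qed

text \<open>
  Delete a maximal set \<open>X\<close> at the cost of one colour. The rest is critical and splits by induction
  into joined parts; counting vertices with \<open>card V + 2 \<le> 2 * chi V\<close> shows that there are at least
  as many parts as vertices in \<open>X\<close>. Call a part a neighbour of \<open>x\<close> if it is not joined to \<open>x\<close>,
  and apply Hall's theorem in its deficiency version. The vertices of \<open>X - Y\<close> are matched to
  parts in \<open>\<F>\<close>, which are joined to all other vertices outside \<open>X - Y\<close>. So absorbing \<open>X - Y\<close> into
  them costs no colour, and a vertex in \<open>X - Y\<close> could be deleted without loss, against
  criticality. Hence \<open>Y = X\<close>. As \<open>X\<close> is nonempty, it has fewer neighbours than elements, so some
  part is left over, and it is joined to the rest of the graph.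
\<close>

lemma gallai_step:
  assumes fin: "finite V" and crit: "critical V" and big: "card V + 2 \<le> 2 * chi V"
    and IH: "\<And>W. W \<subset> V \<Longrightarrow> critical W \<Longrightarrow> \<exists>\<P>. join_partition W \<P>"
  shows "\<exists>A B. A \<noteq> {} \<and> B \<noteq> {} \<and> A \<union> B = V \<and> joined A B"
proof -
  have "V \<noteq> {}" using big by auto
  then obtain X where X: "X \<subseteq> V" "X \<noteq> {}" "chi (V - X) + 1 = chi V" "critical (V - X)"
    using obtain_maximal_deletion[OF fin crit] by blast
  then obtain \<P> where \<P>: "join_partition (V - X) \<P>"
    using IH[of "V - X"] by blast
  have finX: "finite X" using X(1) fin by (rule finite_subset)
  have part: "partition_on (V - X) \<P>" using \<P> by (simp add: join_partition_def)
  have U\<P>: "V - X = \<Union>\<P>" using part by (rule partition_onD1)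
  have fin\<P>: "finite \<P>" using finite_elements[OF _ part] fin by blast
  have finP: "finite P" if "P \<in> \<P>" for P
    using that U\<P> fin by (metis Union_upper finite_Diff finite_subset)
  have "card V = card (V - X) + card X"
    using X(1) finX by (simp add: card_Diff_subset card_mono fin)
  then have many: "card X \<le> card \<P>"
    using join_partition_card[OF _ \<P>] fin big X(3) by simp
  define N where "N x = {P \<in> \<P>. \<not> joined {x} P}" for x
  obtain Y f where Y: "Y \<subseteq> X" "Y = {} \<or> card (\<Union>(N ` Y)) < card Y"
    and f: "inj_on f (X - Y)" "\<And>x. x \<in> X - Y \<Longrightarrow> f x \<in> N x - \<Union>(N ` Y)"
    using hall_deficiency[of X N] finX fin\<P> by (auto simp: N_def)
  define \<F> where "\<F> = \<P> - \<Union>(N ` Y)"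
  define R where "R = V - \<Union>\<F> - (X - Y)"
  have joinR: "joined (\<Union>\<F>) R"
    unfolding joined_def
  proof (intro ballI)
    fix a r assume a: "a \<in> \<Union>\<F>" and r: "r \<in> R"
    obtain P where P: "P \<in> \<F>" "a \<in> P" using a by blast
    show "adj a r"
    proof (cases "r \<in> X")
      case True
      then have "r \<in> Y" using r by (auto simp: R_def)
      then have "joined {r} P" using P by (auto simp: \<F>_def N_def)
      then show ?thesis using P(2) adj_sym by (auto simp: joined_def)
    next
      case False
      then have "r \<in> \<Union>\<P>" using r U\<P> by (auto simp: R_def)
      then obtain Q where Q: "Q \<in> \<P>" "r \<in> Q" by blast
      then have "Q \<noteq> P" using r P by (auto simp: R_def)
      then have "joined P Q" using P Q \<P> by (auto simp: join_partition_def \<F>_def)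
      then show ?thesis using P Q by (auto simp: joined_def)
    qed
  qed
  have F_sub: "\<Union>\<F> \<subseteq> V - X" using U\<P> by (auto simp: \<F>_def)
  have "X - Y = {}"
  proof (rule ccontr)
    assume "X - Y \<noteq> {}"
    then obtain x where x: "x \<in> X - Y" by blast
    have "chi (\<Union>\<F> \<union> (X - Y)) \<le> chi (\<Union>\<F>)"
    proof (rule chi_matched_union)
      show "finite \<F>" using fin\<P> by (simp add: \<F>_def)
      show "inj_on f (X - Y)" by (rule f(1))
      show "f x \<in> \<F> \<and> \<not> joined {x} (f x)" if "x \<in> X - Y" for x
        using f(2)[OF that] by (auto simp: \<F>_def N_def)
    qed (use \<P> finP in \<open>auto simp: \<F>_def join_partition_def\<close>)
    moreover have "V = (\<Union>\<F> \<union> (X - Y)) \<union> R"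
      using F_sub X(1) by (auto simp: R_def)
    then have "chi V \<le> chi (\<Union>\<F> \<union> (X - Y)) + chi R"
      using chi_Un_le[of "\<Union>\<F> \<union> (X - Y)" R] fin by (metis finite_Un)
    moreover have "chi (\<Union>\<F>) + chi R \<le> chi (V - {x})"
      using fin F_sub x joinR by (intro chi_joined_ge) (auto simp: R_def)
    moreover have "chi (V - {x}) < chi V"
      using x X(1) crit by (auto simp: critical_def)
    ultimately show False by linarith
  qed
  then have YX: "Y = X" using Y(1) by blast
  have "card (\<Union>(N ` X)) < card \<P>"
    using Y(2) YX X(2) many by auto
  then have "\<F> \<noteq> {}"
    unfolding \<F>_def YX using card_mono[of "\<Union>(N ` X)" \<P>] finX fin\<P>
    by (auto simp: N_def)
  moreover have "{} \<notin> \<F>"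
    using partition_onD3[OF part] by (simp add: \<F>_def)
  ultimately have "\<Union>\<F> \<noteq> {}" by (metis Union_empty_conv equals0I)
  moreover have "X \<subseteq> R" "\<Union>\<F> \<union> R = V"
    using F_sub X(1) YX by (auto simp: R_def)
  ultimately show ?thesis using joinR X(2) by (metis subset_empty)
qed

lemma critical_joined:
  assumes fin: "finite A" "finite B" and j: "joined A B" and crit: "critical (A \<union> B)"
  shows "critical A"
  unfolding critical_def
proof
  fix a assume a: "a \<in> A"
  have "chi (A - {a}) + chi B \<le> chi (A \<union> B - {a})"
    using fin j a joined_disjoint[OF j] by (intro chi_joined_ge) (auto simp: joined_def)
  also have "\<dots> < chi (A \<union> B)" using a crit by (auto simp: critical_def)
  also have "\<dots> \<le> chi A + chi B" using fin by (rule chi_Un_le)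
  finally show "chi (A - {a}) < chi A" by simp
qed

lemma join_partition_exists:
  assumes "finite V" "critical V"
  shows "\<exists>\<P>. join_partition V \<P>"
  using assms
proof (induction rule: finite_psubset_induct)
  case (psubset V)
  consider "V = {}" | "V \<noteq> {}" "2 * chi V \<le> card V + 1" | "card V + 2 \<le> 2 * chi V"
    by linarith
  then show ?case
  proof cases
    case 1
    then show ?thesis by (auto simp: join_partition_def partition_on_empty)
  next
    case 2
    then have "join_partition V {V}"
      using psubset.prems by (simp add: join_partition_def partition_on_space)
    then show ?thesis ..
  next
    case 3
    have "\<exists>A B. A \<noteq> {} \<and> B \<noteq> {} \<and> A \<union> B = V \<and> joined A B"
      using psubset.IH by (intro gallai_step[OF psubset.hyps psubset.prems 3]) simp
    then obtain A B where AB: "A \<noteq> {}" "B \<noteq> {}" "A \<union> B = V" "joined A B"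
      by blast
    have fin: "finite A" "finite B" using AB(3) psubset.hyps by auto
    have dj: "A \<inter> B = {}" using AB(4) by (rule joined_disjoint)
    have "critical A"
      using critical_joined[OF fin AB(4)] psubset.prems AB(3) by simp
    moreover have "critical B"
      using critical_joined[OF fin(2,1) joined_sym[OF AB(4)]] psubset.prems AB(3)
      by (simp add: Un_commute)
    moreover have "A \<subset> V" "B \<subset> V" using AB dj by auto
    ultimately obtain \<A> \<B> where P: "join_partition A \<A>" "join_partition B \<B>"
      using psubset.IH[of A] psubset.IH[of B] by blast
    have part: "partition_on A \<A>" "partition_on B \<B>"
      using P by (auto simp: join_partition_def)
    have cross: "joined P Q" if "P \<in> \<A>" "Q \<in> \<B>" for P Q
    proof -
      have "P \<subseteq> A" "Q \<subseteq> B" using that part[THEN partition_onD1] by auto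
      then show ?thesis using AB(4) by (auto simp: joined_def)
    qed
    have "joined P Q" if "P \<in> \<A> \<union> \<B>" "Q \<in> \<A> \<union> \<B>" "P \<noteq> Q" for P Q
      using that P cross joined_sym[OF cross] by (auto simp: join_partition_def)
    moreover have "partition_on V (\<A> \<union> \<B>)"
    proof (rule partition_onI)
      show "\<Union>(\<A> \<union> \<B>) = V" using part[THEN partition_onD1] AB(3) by auto
      show "{} \<notin> \<A> \<union> \<B>" using part[THEN partition_onD3] by auto
      show "disjnt P Q" if "P \<in> \<A> \<union> \<B>" "Q \<in> \<A> \<union> \<B>" "P \<noteq> Q" for P Q
        using joined_disjoint[OF calculation[OF that]] by (simp add: disjnt_def)
    qed
    ultimately have "join_partition V (\<A> \<union> \<B>)"
      using P by (auto simp: join_partition_def)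
    then show ?thesis ..
  qed
qed

text \<open>
  Gallai's theorem: a vertex-critical graph on at most \<open>2 * chi V - 2\<close> vertices has a
  disconnected complement.
\<close>

lemma critical_small_join:
  assumes "finite V" "critical V" "card V + 2 \<le> 2 * chi V"
  obtains A B where "A \<noteq> {}" "B \<noteq> {}" "A \<union> B = V" "joined A B"
proof -
  have "\<exists>A B. A \<noteq> {} \<and> B \<noteq> {} \<and> A \<union> B = V \<and> joined A B"
  proof (rule gallai_step[OF assms])
    fix W assume "W \<subset> V" "critical W"
    then show "\<exists>\<P>. join_partition W \<P>"
      using assms(1) by (intro join_partition_exists) (auto intro: finite_subset)
  qed
  then show ?thesis using that by blast
qed

section \<open>Clique number and maximum degree\<close>

lemma omega_ge: "finite V \<Longrightarrow> K \<subseteq> V \<Longrightarrow> clique K \<Longrightarrow> card K \<le> omega V"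
  unfolding omega_def by (rule Max_ge) auto

lemma obtain_max_clique:
  assumes "finite V"
  obtains K where "K \<subseteq> V" "clique K" "card K = omega V"
proof -
  have "omega V \<in> card ` {K. K \<subseteq> V \<and> clique K}"
    unfolding omega_def
  proof (rule Max_in)
    have "clique {}" by (simp add: clique_def)
    then show "card ` {K. K \<subseteq> V \<and> clique K} \<noteq> {}" by blast
  qed (use assms in auto)
  then show ?thesis using that by auto
qed

lemma omega_mono:
  assumes "finite V" "W \<subseteq> V"
  shows "omega W \<le> omega V"
proof -
  obtain K where "K \<subseteq> W" "clique K" "card K = omega W"
    using obtain_max_clique[of W] assms finite_subset by blast
  then show ?thesis using omega_ge[OF assms(1), of K] assms(2) by auto
qed

lemma omega_joined:
  assumes fin: "finite A" "finite B" and j: "joined A B"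
  shows "omega A + omega B \<le> omega (A \<union> B)"
proof -
  obtain K where K: "K \<subseteq> A" "clique K" "card K = omega A"
    using obtain_max_clique[OF fin(1)] .
  obtain L where L: "L \<subseteq> B" "clique L" "card L = omega B"
    using obtain_max_clique[OF fin(2)] .
  have "adj u v \<and> adj v u" if "u \<in> K" "v \<in> L" for u v
    using that K(1) L(1) j adj_sym[of u v] by (auto simp: joined_def)
  then have "clique (K \<union> L)"
    using K(2) L(2) by (auto simp: clique_def)
  then have "card (K \<union> L) \<le> omega (A \<union> B)"
    using fin K(1) L(1) by (intro omega_ge) auto
  moreover have "card (K \<union> L) = card K + card L"
  proof (rule card_Un_disjoint)
    show "K \<inter> L = {}" using joined_disjoint[OF j] K(1) L(1) by auto
  qed (use fin K(1) L(1) finite_subset in auto)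
  ultimately show ?thesis using K(3) L(3) by simp
qed

lemma degree_le_Delta: "finite V \<Longrightarrow> v \<in> V \<Longrightarrow> degree V v \<le> Delta V"
  unfolding Delta_def by (rule Max_ge) auto

lemma Delta_attained:
  assumes "finite V" "V \<noteq> {}"
  obtains v where "v \<in> V" "degree V v = Delta V"
proof -
  obtain w where w: "w \<in> V" using assms(2) by blast
  have "Delta V \<in> insert 0 (degree V ` V)"
    unfolding Delta_def using assms(1) by (intro Max_in) auto
  then consider "Delta V = 0" | v where "v \<in> V" "degree V v = Delta V"
    by auto
  then show ?thesis
  proof cases
    case 1
    then show ?thesis using degree_le_Delta[OF assms(1) w] that[OF w] by simp
  qed (rule that)
qed

lemma degree_mono: "finite V \<Longrightarrow> W \<subseteq> V \<Longrightarrow> degree W v \<le> degree V v"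
  unfolding degree_def by (rule card_mono) auto

lemma Delta_mono:
  assumes "finite V" "W \<subseteq> V"
  shows "Delta W \<le> Delta V"
proof (cases "W = {}")
  case True
  then show ?thesis by (simp add: Delta_def)
next
  case False
  then obtain v where v: "v \<in> W" "degree W v = Delta W"
    using Delta_attained[of W] assms finite_subset by blast
  have "degree W v \<le> degree V v" using assms by (rule degree_mono)
  also have "\<dots> \<le> Delta V" using v(1) assms by (intro degree_le_Delta) auto
  finally show ?thesis using v(2) by simp
qed

lemma Delta_joined:
  assumes fin: "finite A" "finite B" and j: "joined A B" and ne: "A \<noteq> {}"
  shows "Delta A + card B \<le> Delta (A \<union> B)"
proof -
  obtain v where v: "v \<in> A" "degree A v = Delta A"
    using Delta_attained[OF fin(1) ne] .
  have "{u \<in> A \<union> B. adj v u} = {u \<in> A. adj v u} \<union> B"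
    using v(1) j by (auto simp: joined_def)
  moreover have "card ({u \<in> A. adj v u} \<union> B) = card {u \<in> A. adj v u} + card B"
    using fin joined_disjoint[OF j] by (intro card_Un_disjoint) auto
  ultimately have "degree (A \<union> B) v = Delta A + card B"
    using v(2) by (simp add: degree_def)
  then show ?thesis using degree_le_Delta[of "A \<union> B" v] fin v(1) by simp
qed

text \<open>
  For this reason a colour class is enlarged to a maximal independent set before it is removed.
\<close>

lemma Delta_minus_dominating:
  assumes fin: "finite V" and I: "I \<subseteq> V" and ne: "V - I \<noteq> {}"
    and dom: "\<And>v. v \<in> V - I \<Longrightarrow> \<exists>u\<in>I. adj v u"
  shows "Delta (V - I) + 1 \<le> Delta V"
proof -
  obtain v where v: "v \<in> V - I" "degree (V - I) v = Delta (V - I)"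
    using Delta_attained[of "V - I"] fin ne by blast
  obtain u where u: "u \<in> I" "adj v u" using dom[OF v(1)] by blast
  have "{w \<in> V - I. adj v w} \<subset> {w \<in> V. adj v w}"
    using u I by auto
  then have "degree (V - I) v < degree V v"
    unfolding degree_def using fin by (intro psubset_card_mono) auto
  moreover have "degree V v \<le> Delta V" using fin v(1) by (intro degree_le_Delta) auto
  ultimately show ?thesis using v(2) by simp
qed

section \<open>Optimal colorings and their singleton classes\<close>

lemma partition_indep_cover:
  assumes "finite V" "partition_on V C" "\<forall>S\<in>C. indep S"
  shows "indep_cover V C"
  using assms finite_elements[OF assms(1,2)] partition_onD1[OF assms(2)]
  by (simp add: indep_cover_def)

lemma partition_from_cover:
  assumes "indep_cover V D"
  obtains C where "partition_on V C" "\<forall>S\<in>C. indep S" "card C \<le> card D"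
proof -
  have "\<exists>S\<in>D. x \<in> S" if "x \<in> V" for x
    using that assms by (auto simp: indep_cover_def)
  then obtain f where f: "\<And>x. x \<in> V \<Longrightarrow> f x \<in> D \<and> x \<in> f x"
    by metis
  define C where "C = (\<lambda>S. {x \<in> V. f x = S}) ` f ` V"
  have "partition_on V C"
    by (rule partition_onI) (auto simp: C_def disjnt_def)
  moreover have "indep S" if S: "S \<in> C" for S
  proof -
    obtain T where T: "S = {x \<in> V. f x = T}" "T \<in> f ` V"
      using S unfolding C_def by (rule imageE)
    then have "indep T" using f assms by (auto simp: indep_cover_def)
    moreover have "S \<subseteq> T" using T(1) f by auto
    ultimately show ?thesis by (rule indep_subset)
  qed
  moreover have "card C \<le> card D"
  proof -
    have finD: "finite D" using assms by (simp add: indep_cover_def)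
    have "f ` V \<subseteq> D" using f by auto
    then have "card (f ` V) \<le> card D" "finite (f ` V)"
      using finD by (auto intro: card_mono finite_subset)
    then show ?thesis
      unfolding C_def using card_image_le[of "f ` V"] by (meson le_trans)
  qed
  ultimately show ?thesis using that by blast
qed

lemma optimalI:
  assumes "finite V" "partition_on V C" "\<forall>S\<in>C. indep S" "card C \<le> chi V"
  shows "optimal V C"
  using assms chi_le[OF partition_indep_cover[OF assms(1-3)]] by (simp add: optimal_def)

lemma optimal_exists:
  assumes "finite V"
  shows "\<exists>C. optimal V C"
proof -
  obtain D where D: "indep_cover V D" "card D = chi V"
    using obtain_cover[OF assms] .
  obtain C where "partition_on V C" "\<forall>S\<in>C. indep S" "card C \<le> card D"
    using partition_from_cover[OF D(1)] .
  then have "optimal V C" using D(2) by (intro optimalI[OF assms]) simp_all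
  then show ?thesis ..
qed

lemma optimal_insert:
  assumes fin: "finite V" and I: "I \<subseteq> V" "I \<noteq> {}" "indep I"
    and C: "optimal (V - I) C" and chi: "chi (V - I) < chi V"
  shows "optimal V (insert I C)" "I \<notin> C"
proof -
  have part: "partition_on (V - I) C" using C by (simp add: optimal_def)
  have UC: "V - I = \<Union>C" using part by (rule partition_onD1)
  then show "I \<notin> C" using I(1,2) by blast
  show "optimal V (insert I C)"
  proof (rule optimalI[OF fin])
    have "disjnt I (\<Union>C)" unfolding UC[symmetric] by (auto simp: disjnt_def)
    then show "partition_on V (insert I C)"
      using partition_on_insert[of I C V] part I by simp
    have "finite C" using finite_elements[OF _ part] fin by simp
    then have "card (insert I C) \<le> card C + 1"
      by (simp add: card_insert_if)
    then show "card (insert I C) \<le> chi V"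
      using C chi by (simp add: optimal_def)
  qed (use C I in \<open>simp add: optimal_def\<close>)
qed

definition lonely :: "'a set set \<Rightarrow> 'a set set" where
  "lonely C = {S \<in> C. card S = 1}"

text \<open>
  Two nonadjacent singleton classes could be merged, so the singleton classes form a clique.
\<close>

lemma lonely_le_omega:
  assumes fin: "finite V" and C: "optimal V C"
  shows "card (lonely C) \<le> omega V"
proof -
  have part: "partition_on V C" and ind: "\<forall>S\<in>C. indep S" and cardC: "card C = chi V"
    using C by (auto simp: optimal_def)
  have UC: "V = \<Union>C" using part by (rule partition_onD1)
  have finC: "finite C" using finite_elements[OF fin part] .
  define K where "K = {v. {v} \<in> C}"
  have "clique K"
    unfolding clique_def
  proof (intro ballI impI, rule ccontr)
    fix u v assume uv: "u \<in> K" "v \<in> K" "u \<noteq> v" "\<not> adj u v"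
    define D where "D = C - {{u}, {v}}"
    have "indep {u, v}" using uv(4) adj_sym[of v u] by (auto simp: indep_def adj_irrefl)
    then have "indep_cover V (insert {u, v} D)"
      using finC UC ind by (auto simp: indep_cover_def D_def)
    then have "chi V \<le> card (insert {u, v} D)" by (rule chi_le)
    also have "\<dots> \<le> card D + 1" using finC by (simp add: card_insert_if D_def)
    finally have "chi V \<le> card D + 1" .
    moreover have "card {{u}, {v}} = 2" using uv(3) by simp
    then have "card D + 2 = card C"
      unfolding D_def using uv(1,2) finC card_mono[of C "{{u}, {v}}"]
      by (subst card_Diff_subset) (auto simp: K_def)
    ultimately show False using cardC by simp
  qed
  moreover have "K \<subseteq> V" using UC by (auto simp: K_def)
  ultimately have "card K \<le> omega V" using omega_ge[OF fin] by blast
  moreover have "lonely C = (\<lambda>v. {v}) ` K"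
    by (auto simp: lonely_def K_def card_1_singleton_iff)
  then have "card (lonely C) = card K" by (simp add: card_image)
  ultimately show ?thesis by simp
qed

text \<open>
  If no class has more than two vertices, the number of singleton classes is determined by
  \<open>chi V\<close> and \<open>card V\<close>, and bounding the former amounts to bounding \<open>2 * chi V\<close>.
\<close>

lemma card_of_pairs:
  assumes fin: "finite V" and C: "optimal V C" and pairs: "\<And>S. S \<in> C \<Longrightarrow> card S \<le> 2"
  shows "2 * chi V = card V + card (lonely C)"
proof -
  have part: "partition_on V C" using C by (simp add: optimal_def)
  have finC: "finite C" using finite_elements[OF fin part] .
  have "card S > 0" if "S \<in> C" for S
    using that fin partition_onD1[OF part] partition_onD3[OF part]
    by (metis Union_upper card_gt_0_iff finite_subset)
  then have "card S + (if card S = 1 then 1 else 0) = 2" if "S \<in> C" for S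
    using pairs[OF that] that by fastforce
  then have "(\<Sum>S\<in>C. card S + (if card S = 1 then 1 else 0)) = (\<Sum>S\<in>C. 2)"
    by (intro sum.cong) auto
  then have "(\<Sum>S\<in>C. card S) + (\<Sum>S\<in>C. if card S = 1 then 1 else 0) = 2 * card C"
    by (simp add: sum.distrib)
  moreover have "(\<Sum>S\<in>C. if card S = 1 then 1 else 0) = card (lonely C)"
    using finC by (simp add: lonely_def sum.If_cases Int_def)
  ultimately show ?thesis
    using card_partition_sum[OF fin part] C by (simp add: optimal_def)
qed

section \<open>The bound\<close>

text \<open>
  Asking for one good optimal coloring, in place of a maximum over all of them, is what the
  induction can carry along when a class is added back.
\<close>

definition stingy_bound :: "'a set \<Rightarrow> bool" where
  "stingy_bound V \<longleftrightarrow>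
     (\<exists>C. optimal V C \<and> 4 * chi V \<le> card (lonely C) + omega V + Delta V + card V + 2)"

lemma stingy_bound_clique:
  assumes "finite V" "stingy_bound V"
  shows "4 * chi V \<le> 2 * omega V + Delta V + card V + 2"
proof -
  obtain C where C: "optimal V C" "4 * chi V \<le> card (lonely C) + omega V + Delta V + card V + 2"
    using assms(2) by (auto simp: stingy_bound_def)
  then show ?thesis using lonely_le_omega[OF assms(1) C(1)] by linarith
qed

text \<open>
  A graph that is not critical loses a vertex without losing a colour. A critical one is a join of
  \<open>A\<close> and \<open>B\<close> by Gallai's theorem. For both sides, \<open>stingy_bound\<close> with the number of singleton
  classes replaced by the clique number gives
  \<open>4 * chi A \<le> 2 * omega A + Delta A + card A + 2\<close>. In the sum of the two inequalities the terms
  \<open>Delta A + card B\<close> and \<open>Delta B + card A\<close> are both at most \<open>Delta V\<close>, and halving gives the claim.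
\<close>

lemma reed_bound_large_chi:
  assumes "finite V" "\<And>W. W \<subset> V \<Longrightarrow> stingy_bound W" "card V + 2 \<le> 2 * chi V"
  shows "2 * chi V \<le> omega V + Delta V + 2"
  using assms
proof (induction rule: finite_psubset_induct)
  case (psubset V)
  note fin = psubset.hyps
  show ?case
  proof (cases "critical V")
    case False
    then obtain v where v: "v \<in> V" "chi V \<le> chi (V - {v})"
      by (auto simp: critical_def not_less)
    have "2 * chi (V - {v}) \<le> omega (V - {v}) + Delta (V - {v}) + 2"
    proof (rule psubset.IH)
      show "V - {v} \<subset> V" using v(1) by blast
      show "stingy_bound W" if "W \<subset> V - {v}" for W
        using that by (intro psubset.prems(1)) blast
      show "card (V - {v}) + 2 \<le> 2 * chi (V - {v})"
        using psubset.prems(2) v card_Diff1_le[of V v] by linarith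
    qed
    moreover have "omega (V - {v}) \<le> omega V" "Delta (V - {v}) \<le> Delta V"
      using fin by (auto intro: omega_mono Delta_mono)
    ultimately show ?thesis using v(2) by linarith
  next
    case True
    then obtain A B where AB: "A \<noteq> {}" "B \<noteq> {}" "A \<union> B = V" "joined A B"
      using critical_small_join[OF fin _ psubset.prems(2)] by metis
    have finAB: "finite A" "finite B" using fin AB(3) by auto
    have "A \<subset> V" "B \<subset> V" using AB joined_disjoint[OF AB(4)] by auto
    then have "4 * chi A \<le> 2 * omega A + Delta A + card A + 2"
      and "4 * chi B \<le> 2 * omega B + Delta B + card B + 2"
      using stingy_bound_clique finAB psubset.prems(1) by auto
    moreover have "chi V \<le> chi A + chi B"
      using chi_Un_le[OF finAB] AB(3) by simp
    moreover have "omega A + omega B \<le> omega V"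
      using omega_joined[OF finAB AB(4)] AB(3) by simp
    moreover have "Delta A + card B \<le> Delta V"
      using Delta_joined[OF finAB AB(4,1)] AB(3) by simp
    moreover have "Delta B + card A \<le> Delta V"
      using Delta_joined[OF finAB(2,1) joined_sym[OF AB(4)] AB(2)] AB(3) by (simp add: Un_commute)
    ultimately show ?thesis by linarith
  qed
qed

lemma obtain_maximal_indep:
  assumes fin: "finite V" and S: "S \<subseteq> V" "indep S"
  obtains I where "S \<subseteq> I" "I \<subseteq> V" "indep I" "\<And>v. v \<in> V - I \<Longrightarrow> \<exists>u\<in>I. adj v u"
proof -
  define \<I> where "\<I> = {I. I \<subseteq> V \<and> indep I}"
  have "finite \<I>" by (rule finite_subset[of _ "Pow V"]) (use fin in \<open>auto simp: \<I>_def\<close>)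
  moreover have "S \<in> \<I>" using S by (simp add: \<I>_def)
  ultimately obtain I where I: "I \<in> \<I>" "S \<subseteq> I" "\<And>J. J \<in> \<I> \<Longrightarrow> I \<subseteq> J \<Longrightarrow> I = J"
    using finite_has_maximal2[of \<I> S] by blast
  have "\<exists>u\<in>I. adj v u" if v: "v \<in> V - I" for v
  proof (rule ccontr)
    assume n: "\<not> (\<exists>u\<in>I. adj v u)"
    then have "\<not> adj u v" if "u \<in> I" for u using adj_sym[of u v] that by blast
    then have "indep (insert v I)"
      using n I(1) by (auto simp: indep_def \<I>_def adj_irrefl)
    then have "I = insert v I" using I(1) v by (intro I(3)) (auto simp: \<I>_def)
    then show False using v by blast
  qed
  then show ?thesis using that[of I] I by (auto simp: \<I>_def)
qed

text \<open>
  Removing a maximal independent set \<open>I\<close> that contains \<open>S\<close> lowers \<open>chi\<close> by one and, unless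
  nothing is left, \<open>Delta\<close> by at least one. As \<open>I\<close> has three vertices or more, the loss of \<open>4\<close> on
  the left is paid for by \<open>card V\<close> and \<open>Delta V\<close>, and \<open>I\<close> is not a singleton class when it is
  added back.
\<close>

lemma stingy_bound_remove_class:
  assumes fin: "finite V" and IH: "\<And>W. W \<subset> V \<Longrightarrow> stingy_bound W"
    and C: "optimal V C" "S \<in> C" "card S \<ge> 3"
  shows "stingy_bound V"
proof -
  have part: "partition_on V C" and ind: "\<forall>S\<in>C. indep S" and cardC: "card C = chi V"
    using C(1) by (auto simp: optimal_def)
  have finC: "finite C" using finite_elements[OF fin part] .
  have UC: "V = \<Union>C" using part by (rule partition_onD1)
  obtain I where I: "S \<subseteq> I" "I \<subseteq> V" "indep I" "\<And>v. v \<in> V - I \<Longrightarrow> \<exists>u\<in>I. adj v u"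
    using obtain_maximal_indep[OF fin, of S] C(2) UC ind by blast
  have finI: "finite I" using I(2) fin by (rule finite_subset)
  have cardI: "card I \<ge> 3" using C(3) card_mono[OF finI I(1)] by linarith
  then have I_ne: "I \<noteq> {}" by auto
  have "indep_cover (V - I) (C - {S})"
    using finC UC ind I(1) by (auto simp: indep_cover_def)
  then have "chi (V - I) \<le> card (C - {S})" by (rule chi_le)
  then have less: "chi (V - I) < chi V"
    using C(2) finC cardC card_Diff1_less[OF finC C(2)] by linarith
  have "chi V \<le> chi (V - I) + chi I"
    using chi_Un_le[of "V - I" I] fin finI I(2) by (simp add: Un_absorb2)
  then have chi: "chi V \<le> chi (V - I) + 1"
    using chi_indep[OF I(3)] by linarith
  have cardV: "card V = card (V - I) + card I"
    using card_Diff_subset[OF finI I(2)] card_mono[OF fin I(2)] by simp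
  obtain D where D: "optimal (V - I) D"
    "4 * chi (V - I) \<le> card (lonely D) + omega (V - I) + Delta (V - I) + card (V - I) + 2"
    using IH[of "V - I"] I(2) I_ne by (auto simp: stingy_bound_def)
  have "lonely (insert I D) = lonely D" using cardI by (auto simp: lonely_def)
  moreover have "optimal V (insert I D)"
    using optimal_insert[OF fin I(2) I_ne I(3) D(1) less] by simp
  moreover have "4 * chi V \<le> card (lonely D) + omega V + Delta V + card V + 2"
  proof (cases "V - I = {}")
    case True
    then show ?thesis using chi cardV cardI by (simp add: True)
  next
    case False
    have "Delta (V - I) + 1 \<le> Delta V"
      using Delta_minus_dominating[OF fin I(2) False I(4)] .
    moreover have "omega (V - I) \<le> omega V" using fin by (auto intro: omega_mono)
    ultimately show ?thesis using D(2) chi cardV cardI by linarith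
  qed
  ultimately show ?thesis unfolding stingy_bound_def by metis
qed

text \<open>
  Without an independent triple, the vertices other than \<open>v\<close> and its neighbours form a clique, so
  \<open>card V \<le> omega V + Delta V + 1\<close>.
\<close>

lemma reed_bound_no_triple:
  assumes fin: "finite V" and ne: "V \<noteq> {}" and small: "2 * chi V \<le> card V + 1"
    and no_triple: "\<And>I. I \<subseteq> V \<Longrightarrow> indep I \<Longrightarrow> card I \<noteq> 3"
  shows "2 * chi V \<le> omega V + Delta V + 2"
proof -
  obtain v where v: "v \<in> V" using ne by blast
  define N where "N = {u \<in> V. u \<noteq> v \<and> \<not> adj v u}"
  have "clique N"
    unfolding clique_def
  proof (intro ballI impI, rule ccontr)
    fix x y assume xy: "x \<in> N" "y \<in> N" "x \<noteq> y" "\<not> adj x y"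
    have "indep {v, x, y}"
      using xy adj_sym[of x v] adj_sym[of y v] adj_sym[of y x]
      by (auto simp: indep_def N_def adj_irrefl)
    moreover have "{v, x, y} \<subseteq> V" using xy v by (auto simp: N_def)
    moreover have "card {v, x, y} = 3" using xy by (auto simp: N_def)
    ultimately show False using no_triple by blast
  qed
  then have "card N \<le> omega V" using fin by (intro omega_ge) (auto simp: N_def)
  moreover have "card V \<le> 1 + card N + degree V v"
  proof -
    have V: "V = insert v (N \<union> {u \<in> V. adj v u})"
      using v by (auto simp: N_def)
    have "card V \<le> card (N \<union> {u \<in> V. adj v u}) + 1"
      using fin by (subst V) (simp add: card_insert_if N_def)
    then show ?thesis
      using card_Un_le[of N "{u \<in> V. adj v u}"] by (simp add: degree_def)
  qed
  ultimately show ?thesis using degree_le_Delta[OF fin v] small by linarith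
qed

text \<open>
  In the remaining case of the induction all classes of optimal colorings have at most two
  vertices. Then removing an independent triple \<open>I\<close> does not save a colour, since \<open>I\<close> would
  otherwise be a class of an optimal coloring. Hence \<open>V - I\<close> has large chromatic number relative
  to its size and \<open>reed_bound_large_chi\<close> applies to it.
\<close>

lemma stingy_bound_all:
  assumes "finite V"
  shows "stingy_bound V"
  using assms
proof (induction rule: finite_psubset_induct)
  case (psubset V)
  note fin = psubset.hyps and IH = psubset.IH
  show ?case
  proof (cases "\<exists>C S. optimal V C \<and> S \<in> C \<and> card S \<ge> 3")
    case True
    then show ?thesis using stingy_bound_remove_class[OF fin IH] by blast
  next
    case small: False
    obtain C where C: "optimal V C" using optimal_exists[OF fin] by blast
    have "card S \<le> 2" if "S \<in> C" for S
    proof (rule ccontr)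
      assume "\<not> card S \<le> 2"
      then have "3 \<le> card S" by simp
      then show False using small C that by blast
    qed
    then have pairs: "2 * chi V = card V + card (lonely C)"
      by (rule card_of_pairs[OF fin C])
    have "2 * chi V \<le> omega V + Delta V + 2"
    proof (cases "\<exists>I. I \<subseteq> V \<and> indep I \<and> card I = 3")
      case True
      then obtain I where I: "I \<subseteq> V" "indep I" "card I = 3" by blast
      then have I_ne: "I \<noteq> {}" by auto
      have "chi V \<le> chi (V - I)"
      proof (rule ccontr)
        assume "\<not> chi V \<le> chi (V - I)"
        then have less: "chi (V - I) < chi V" by simp
        obtain D where "optimal (V - I) D" using optimal_exists[of "V - I"] fin by blast
        from optimal_insert(1)[OF fin I(1) I_ne I(2) this less]
        show False using small I(3) by (metis insertI1 order_refl)
      qed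
      moreover have "card (V - I) \<le> card V - 3"
        using card_Diff_subset[of I V] I fin finite_subset by (metis order_refl)
      moreover have "card V \<ge> 3" using card_mono[OF fin I(1)] I(3) by simp
      ultimately have large: "card (V - I) + 2 \<le> 2 * chi (V - I)"
        using pairs by linarith
      have "2 * chi (V - I) \<le> omega (V - I) + Delta (V - I) + 2"
      proof (rule reed_bound_large_chi[OF _ _ large])
        show "finite (V - I)" using fin by simp
        show "stingy_bound W" if "W \<subset> V - I" for W
          using that by (intro IH) blast
      qed
      moreover have "omega (V - I) \<le> omega V" "Delta (V - I) \<le> Delta V"
        using fin by (auto intro: omega_mono Delta_mono)
      ultimately show ?thesis using \<open>chi V \<le> chi (V - I)\<close> by linarith
    next
      case no_triple: False
      consider "V = {}" | "card V + 2 \<le> 2 * chi V" | "V \<noteq> {}" "2 * chi V \<le> card V + 1"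
        by linarith
      then show ?thesis
      proof cases
        case 2
        then show ?thesis using reed_bound_large_chi[OF fin IH] by blast
      next
        case 3
        then show ?thesis using reed_bound_no_triple[OF fin] no_triple by blast
      qed simp
    qed
    then show ?thesis
      unfolding stingy_bound_def using C pairs by (intro exI[of _ C]) linarith
  qed
qed

end

section \<open>The bound for graphs\<close>

theorem mainTheorem2:
  fixes G :: "('a, 'b) pre_digraph"
  assumes "graph G"
  shows "real (chromatic_number G) \<le>
    (real (stinginess G) + real (clique_number G) + real (max_degree G) + real (card (verts G)) + 2) / 4"
proof -
  interpret graph G by (rule assms)
  define adj where "adj u v \<longleftrightarrow> u \<rightarrow>\<^bsub>G\<^esub> v" for u v
  interpret A: adjacency adj
  proof
    show "adj u v \<Longrightarrow> adj v u" for u v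
      unfolding adj_def using sym_arcs by (auto simp: symmetric_def dest: symD)
    show "\<not> adj u u" for u
      unfolding adj_def by (auto dest: adj_not_same)
  qed
  have coloring: "coloring G C \<longleftrightarrow> partition_on (verts G) C \<and> (\<forall>S\<in>C. A.indep S)" for C
  proof -
    have "S \<subseteq> verts G" if "partition_on (verts G) C" "S \<in> C" for S
      using partition_onD1[OF that(1)] that(2) by blast
    then show ?thesis
      unfolding coloring_def independent_set_def A.indep_def adj_def by blast
  qed
  have chi: "chromatic_number G = A.chi (verts G)"
  proof (rule antisym)
    obtain C where "A.optimal (verts G) C" using A.optimal_exists[OF finite_verts] by blast
    then have "coloring G C" "card C = A.chi (verts G)"
      by (auto simp: A.optimal_def coloring)
    then show "chromatic_number G \<le> A.chi (verts G)"
      unfolding chromatic_number_def by (intro Least_le) blast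
    obtain D where "coloring G D" "card D = chromatic_number G"
      using optimal_coloring_exists by (auto simp: optimal_coloring_def)
    then show "A.chi (verts G) \<le> chromatic_number G"
      using A.chi_le[OF A.partition_indep_cover[OF finite_verts, of D]] by (simp add: coloring)
  qed
  obtain C where C: "A.optimal (verts G) C" and bound:
    "4 * A.chi (verts G) \<le> card (A.lonely C) + A.omega (verts G) + A.Delta (verts G) + card (verts G) + 2"
    using A.stingy_bound_all[OF finite_verts] by (auto simp: A.stingy_bound_def)
  have "optimal_coloring G C"
    using C by (simp add: optimal_coloring_def coloring chi A.optimal_def)
  then have "card (A.lonely C) \<le> stinginess G"
    unfolding stinginess_def A.lonely_def
    by (intro Max_ge[OF stinginess_set(1)]) blast
  moreover have "A.omega (verts G) = clique_number G"
    unfolding A.omega_def clique_number_def clique_set_def A.clique_def adj_def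
    by (rule arg_cong[where f = Max]) auto
  moreover have "A.Delta (verts G) = max_degree G"
    unfolding A.Delta_def max_degree_def A.degree_def[abs_def] adj_def out_degree_eq_card_neighbours
    by simp
  ultimately have "4 * chromatic_number G
      \<le> stinginess G + clique_number G + max_degree G + card (verts G) + 2"
    using bound chi by linarith
  then have "4 * real (chromatic_number G)
      \<le> real (stinginess G) + real (clique_number G) + real (max_degree G) + real (card (verts G)) + 2"
    by (metis (mono_tags, lifting) of_nat_add of_nat_le_iff of_nat_mult of_nat_numeral)
  then show ?thesis by simp
qed

end
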